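(* Let $s\ge 2$ be an integer, let $P=(p_1,\dots,p_n)$ be a probability distribution on $[n]$ with $p_i\le\frac1{2s}$ for all $i$, let $A=(\alpha_1,\dots,\alpha_n)$ be an arbitrary vector with non-negative entries, and let $r\ge 0$. Let $W=\sum_{i=1}^n\alpha_i c_i$ where $(c_1,\dots,c_n)$ is the configuration obtained by type I sampling $s$ times from $P$, and let $W'=\sum_{i=1}^n\alpha_i c_i'$ where $(c_1',\dots,c_n')$ is the configuration obtained by type II sampling $s$ times from $P$. Then $$P^{(I)}\big[\,|W-\mathrm E[W]|>r\,\big]\ \le\ 30\,s^{3/2}\,P^{(II)}\big[\,|W'-\mathrm E[W']|>r\,\big]+\frac1{s^{\ln\ln s}} .$$
   Context: A configuration records, for each $i\in[n]=\{1,\dots,n\}$, the number of times $c_i$ that element $i$ was selected. Type I sampling $s$ times from $P$: draw $s$ independent samples from $P$. Type II sampling $s$ times from $P$: for each $i\in[n]$ independently, flip a coin with heads-probability $p_i$ independently $s$ times, and select element $i$ every time heads comes up (so the counts $c_i'$ are independent Binomial$(s,p_i)$ variables). $P^{(I)}[\cdot]$ and $P^{(II)}[\cdot]$ denote probabilities under type I and type II sampling respectively. *)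

theory Defs
  imports "HOL-Probability.Probability" "HOL-Probability.Product_PMF"
begin

text \<open>A configuration is a function giving, for each element, the number of times it was
  selected. The ground set \<open>{1..n}\<close> is a set of natural numbers, and a distribution
  on it is a \<open>nat pmf\<close> \<open>P\<close> with \<open>set_pmf P \<subseteq> {1..n}\<close>; \<open>pmf P i\<close> is then the
  probability \<open>p\<^sub>i\<close> (possibly zero).\<close>

definition type_I_sampling :: "nat \<Rightarrow> nat pmf \<Rightarrow> (nat \<Rightarrow> nat) pmf" where
  "type_I_sampling s P = map_pmf count_list (replicate_pmf s P)"

text \<open>Type II sampling flips \<open>s\<close> independent coins of bias \<open>p\<^sub>i\<close> for each \<open>i\<close>, independently
  over \<open>i\<close>; counts outside \<open>{1..n}\<close> are set to \<open>0\<close>.\<close>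

definition type_II_sampling :: "nat \<Rightarrow> nat \<Rightarrow> nat pmf \<Rightarrow> (nat \<Rightarrow> nat) pmf" where
  "type_II_sampling n s P =
     Pi_pmf {1..n} 0
       (\<lambda>i. map_pmf (\<lambda>flips. count_list flips True) (replicate_pmf s (bernoulli_pmf (pmf P i))))"

definition weight :: "nat \<Rightarrow> (nat \<Rightarrow> real) \<Rightarrow> (nat \<Rightarrow> nat) \<Rightarrow> real" where
  "weight n \<alpha> c = (\<Sum>i = 1..n. \<alpha> i * real (c i))"

lemma type_II_sampling_binomial:
  "type_II_sampling n s P = Pi_pmf {1..n} 0 (\<lambda>i. binomial_pmf s (pmf P i))"
proof -
  have "count_list bs True = length (filter id bs)" for bs
    by (induction bs) auto
  then show ?thesis
    unfolding type_II_sampling_def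
    by (intro Pi_pmf_cong) (auto simp: binomial_pmf_altdef pmf_le_1 o_def)
qed

end

theory Submission
  imports Defs
begin

text \<open>
  Both sampling schemes give each \<open>c\<^sub>i\<close> the binomial distribution, so the means agree. A
  configuration \<open>c\<close> with \<open>\<Sum> c\<^sub>i = s\<close> has type I probability \<open>s! \<Prod> p\<^sub>i ^ c\<^sub>i / c\<^sub>i!\<close>, and its
  likelihood ratio against type II is \<open>s!\<close> divided by the product of the
  \<open>s (s - 1) \<dots> (s - c\<^sub>i + 1) (1 - p\<^sub>i) ^ (s - c\<^sub>i)\<close>. If every \<open>c\<^sub>i\<close> is at most \<open>2 ln s + 1\<close>,
  the falling factorials multiply to at least \<open>s ^ s / s\<close> up to a constant, the powers of
  \<open>1 - p\<^sub>i\<close> to at least \<open>exp (- s)\<close> up to a constant, and \<open>s! \<le> e sqrt s (s / e) ^ s\<close>, so the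
  ratio is of order \<open>s powr (3 / 2)\<close>. The probability under type I that some \<open>c\<^sub>i\<close> is at least
  \<open>k\<close> is at most \<open>\<Sum> (s choose k) p\<^sub>i ^ k \<le> 2 s / (2 ^ k k!)\<close>; for \<open>k\<close> about \<open>2 ln s\<close> this is
  absorbed by \<open>1 / s powr (ln (ln s))\<close>, whose exponent is negative when \<open>s = 2\<close>.
\<close>

section \<open>Point probabilities of the two sampling schemes\<close>

lemma pmf_replicate_pmf:
  "pmf (replicate_pmf s P) xs = (if length xs = s then prod_list (map (pmf P) xs) else 0)"
proof (induction s arbitrary: xs)
  case 0
  then show ?case by (cases xs) auto
next
  case (Suc s)
  have eq: "replicate_pmf (Suc s) P = map_pmf (\<lambda>(x, xs). x # xs) (pair_pmf P (replicate_pmf s P))"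
    by (simp add: pair_pmf_def map_bind_pmf map_pmf_def bind_assoc_pmf bind_return_pmf)
  show ?case
  proof (cases xs)
    case Nil
    then show ?thesis by (auto simp: pmf_eq_0_set_pmf set_replicate_pmf)
  next
    case (Cons x ys)
    have "pmf (replicate_pmf (Suc s) P) xs = pmf (pair_pmf P (replicate_pmf s P)) (x, ys)"
      unfolding eq Cons
      by (subst pmf_map_inj'[where f = "\<lambda>(x, xs). x # xs", symmetric]) (auto simp: inj_on_def)
    then show ?thesis by (simp add: pmf_pair Suc Cons)
  qed
qed

lemma count_mset_eq_count_list: "count (mset xs) = count_list xs"
  by (rule ext) (induction xs, auto)

lemma prod_list_map_eq_prod_count_list:
  fixes f :: "'a \<Rightarrow> 'b :: comm_monoid_mult"
  assumes "finite A" "set xs \<subseteq> A"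
  shows "prod_list (map f xs) = (\<Prod>i\<in>A. f i ^ count_list xs i)"
proof -
  have "prod_list (map f xs) = prod_mset (image_mset f (mset xs))"
    by (simp flip: prod_mset_prod_list)
  also have "\<dots> = (\<Prod>i\<in>set xs. f i ^ count_list xs i)"
    by (simp add: image_prod_mset_multiplicity count_mset_eq_count_list)
  also have "\<dots> = (\<Prod>i\<in>A. f i ^ count_list xs i)"
    using assms by (intro prod.mono_neutral_left) auto
  finally show ?thesis .
qed

lemma lists_with_same_counts:
  "{ys. count_list ys = count_list xs} = permutations_of_multiset (mset xs)"
  by (auto simp: permutations_of_multiset_def multiset_eq_iff count_mset_eq_count_list)

text \<open>A multinomial count: lists with equal counts are the permutations of one multiset, and
  points of \<open>A\<close> outside \<open>set xs\<close> only contribute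
  \<open>fact 0 = 1\<close>.\<close>

lemma card_lists_with_same_counts:
  assumes "finite A" "set xs \<subseteq> A"
  shows "card {ys. count_list ys = count_list xs} * (\<Prod>i\<in>A. fact (count_list xs i)) = fact (length xs)"
proof -
  have "(\<Prod>i\<in>A. fact (count_list xs i)) = (\<Prod>i\<in>set xs. fact (count_list xs i) :: nat)"
    using assms by (intro prod.mono_neutral_right) (auto simp: count_list_0_iff)
  then show ?thesis
    using card_permutations_of_multiset_aux[of "mset xs"]
    by (simp add: lists_with_same_counts count_mset_eq_count_list)
qed

text \<open>All lists with counts \<open>c\<close> are equally likely, so the mass is a multinomial
  coefficient times the probability of one list. Membership in the support ensures that
  \<open>c\<close> comes from a list of length \<open>s\<close>.\<close>

lemma pmf_type_I_sampling:
  assumes "finite A" "set_pmf P \<subseteq> A" "c \<in> set_pmf (type_I_sampling s P)"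
  shows "pmf (type_I_sampling s P) c = fact s * (\<Prod>i\<in>A. pmf P i ^ c i / fact (c i))"
proof -
  from assms(3) obtain xs where xs: "set xs \<subseteq> set_pmf P" "length xs = s" "c = count_list xs"
    by (auto simp: type_I_sampling_def set_replicate_pmf)
  define L where "L = {ys. count_list ys = count_list xs}"
  have L_eq: "L = permutations_of_multiset (mset xs)"
    unfolding L_def by (rule lists_with_same_counts)
  have "pmf (type_I_sampling s P) c = measure_pmf.prob (replicate_pmf s P) L"
    unfolding type_I_sampling_def pmf_map L_def xs(3) by (simp add: vimage_def)
  also have "\<dots> = (\<Sum>ys\<in>L. pmf (replicate_pmf s P) ys)"
    by (rule measure_measure_pmf_finite) (simp add: L_eq)
  also have "\<dots> = (\<Sum>ys\<in>L. \<Prod>i\<in>A. pmf P i ^ c i)"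
  proof (rule sum.cong[OF refl])
    fix ys assume "ys \<in> L"
    then have "set ys = set xs" "length ys = s" "count_list ys = c"
      using xs by (auto simp: L_eq permutations_of_multiset_def L_def
          dest: mset_eq_setD mset_eq_length simp flip: count_mset_eq_count_list)
    then show "pmf (replicate_pmf s P) ys = (\<Prod>i\<in>A. pmf P i ^ c i)"
      using xs assms
      by (simp add: pmf_replicate_pmf prod_list_map_eq_prod_count_list[of A ys])
  qed
  also have "\<dots> = real (card L) * (\<Prod>i\<in>A. pmf P i ^ c i)" by simp
  also have "real (card L) = fact s / (\<Prod>i\<in>A. fact (c i))"
  proof -
    have "real (card L * (\<Prod>i\<in>A. fact (c i))) = real (fact s)"
      using card_lists_with_same_counts[of A xs] assms xs by (simp add: L_def)
    moreover have "(\<Prod>i\<in>A. fact (c i) :: real) \<noteq> 0"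
      using assms(1) by simp
    ultimately show ?thesis by (simp add: nonzero_eq_divide_eq)
  qed
  finally show ?thesis by (simp add: prod_dividef)
qed

lemma pmf_type_II_sampling:
  assumes "\<And>i. i \<notin> {1..n} \<Longrightarrow> c i = 0"
  shows "pmf (type_II_sampling n s P) c =
    (\<Prod>i=1..n. real (s choose c i) * pmf P i ^ c i * (1 - pmf P i) ^ (s - c i))"
  using assms unfolding type_II_sampling_binomial by (subst pmf_Pi') (auto simp: pmf_le_1)

section \<open>Binomial marginals and equality of means\<close>

text \<open>Each draw hits \<open>i\<close> with probability \<open>pmf P i\<close> and so adds one
  independent Bernoulli trial to the count.\<close>

lemma map_pmf_type_I_sampling: "map_pmf (\<lambda>c. c i) (type_I_sampling s P) = binomial_pmf s (pmf P i)"
proof (induction s)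
  case 0
  then show ?case by (simp add: type_I_sampling_def binomial_pmf_0 pmf_le_1)
next
  case (Suc s)
  have bern: "map_pmf (\<lambda>x. x = i) P = bernoulli_pmf (pmf P i)"
  proof (rule pmf_eqI)
    fix b
    show "pmf (map_pmf (\<lambda>x. x = i) P) b = pmf (bernoulli_pmf (pmf P i)) b"
    proof (cases b)
      case True
      have "(\<lambda>x. x = i) -` {True} = {i}" by auto
      then show ?thesis using True by (simp add: pmf_map measure_pmf_single pmf_le_1)
    next
      case False
      have "(\<lambda>x. x = i) -` {False} = UNIV - {i}" by auto
      then show ?thesis using False measure_pmf.prob_compl[of "{i}" P]
        by (simp add: pmf_map measure_pmf_single pmf_le_1)
    qed
  qed
  have "map_pmf (\<lambda>c. c i) (type_I_sampling (Suc s) P) =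
     do {x \<leftarrow> P; k \<leftarrow> map_pmf (\<lambda>c. c i) (type_I_sampling s P); return_pmf ((if x = i then 1 else 0) + k)}"
    by (auto simp: type_I_sampling_def map_pmf_def bind_assoc_pmf bind_return_pmf intro!: bind_pmf_cong)
  also have "\<dots> = do {b \<leftarrow> map_pmf (\<lambda>x. x = i) P; k \<leftarrow> binomial_pmf s (pmf P i);
      return_pmf ((if b then 1 else 0) + k)}"
    by (simp add: Suc bind_map_pmf)
  also have "\<dots> = binomial_pmf (Suc s) (pmf P i)"
    unfolding bern by (subst binomial_pmf_Suc) (auto simp: pmf_le_1)
  finally show ?case .
qed

lemma map_pmf_type_II_sampling:
  "i \<in> {1..n} \<Longrightarrow> map_pmf (\<lambda>c. c i) (type_II_sampling n s P) = binomial_pmf s (pmf P i)"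
  unfolding type_II_sampling_binomial by (subst Pi_pmf_component) auto

text \<open>By linearity the mean depends on \<open>D\<close> only through its marginals, so type I,
  whose counts are dependent, and type II have the same mean.\<close>

lemma expectation_weight:
  assumes "\<And>i. i \<in> {1..n} \<Longrightarrow> map_pmf (\<lambda>c. c i) D = binomial_pmf s (pmf P i)"
  shows "measure_pmf.expectation D (weight n \<alpha>) =
    (\<Sum>i=1..n. \<alpha> i * measure_pmf.expectation (binomial_pmf s (pmf P i)) real)"
proof -
  have "integrable (map_pmf (\<lambda>c. c i) D) real" if "i \<in> {1..n}" for i
    using that assms by (simp add: pmf_le_1)
  then have int: "integrable D (\<lambda>c. real (c i))" if "i \<in> {1..n}" for i
    using that by (simp add: integrable_map_pmf_eq)
  have "measure_pmf.expectation D (weight n \<alpha>) = (\<Sum>i=1..n. \<alpha> i * measure_pmf.expectation D (\<lambda>c. real (c i)))"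
    unfolding weight_def using int by (subst Bochner_Integration.integral_sum) auto
  also have "\<dots> = (\<Sum>i=1..n. \<alpha> i * measure_pmf.expectation (map_pmf (\<lambda>c. c i) D) real)"
    by simp
  also have "\<dots> = (\<Sum>i=1..n. \<alpha> i * measure_pmf.expectation (binomial_pmf s (pmf P i)) real)"
    using assms by (intro sum.cong) (auto simp del: integral_map_pmf)
  finally show ?thesis .
qed

section \<open>Binomial tails and comparison of probabilities\<close>

text \<open>This is the union bound over the \<open>k\<close>-subsets of trials that all succeed.
  The induction conditions on the first trial and recombines the two cases by Pascal's rule, hence
  the arbitrary \<open>k\<close>.\<close>

lemma prob_binomial_pmf_ge:
  assumes "0 \<le> p" "p \<le> 1"
  shows "measure_pmf.prob (binomial_pmf s p) {k..} \<le> real (s choose k) * p ^ k"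
proof (induction s arbitrary: k)
  case 0
  then show ?case using assms by (cases k) (auto simp: binomial_pmf_0)
next
  case (Suc s)
  let ?B = "binomial_pmf s p"
  show ?case
  proof (cases k)
    case 0
    then show ?thesis by simp
  next
    case (Suc j)
    have "binomial_pmf (Suc s) p = bernoulli_pmf p \<bind> (\<lambda>b. map_pmf ((+) (if b then 1 else 0)) ?B)"
      using assms by (simp add: binomial_pmf_Suc map_pmf_def)
    then have "measure_pmf.prob (binomial_pmf (Suc s) p) {k..} =
        measure_pmf.expectation (bernoulli_pmf p)
          (\<lambda>b. measure_pmf.prob (map_pmf ((+) (if b then 1 else 0)) ?B) {k..})"
      by (simp add: measure_pmf_bind measure_pmf.measure_bind[where N = "count_space UNIV"] measure_subprob)
    also have "\<dots> = p * measure_pmf.prob ?B {j..} + (1 - p) * measure_pmf.prob ?B {k..}"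
    proof -
      have "(+) 1 -` {k..} = {j..}" "(+) 0 -` {k..} = {k..}" using Suc by auto
      then show ?thesis using assms by (simp add: measure_map_pmf)
    qed
    also have "\<dots> \<le> p * (real (s choose j) * p ^ j) + 1 * (real (s choose k) * p ^ k)"
      using assms by (intro add_mono mult_mono Suc.IH) auto
    also have "\<dots> = real (Suc s choose k) * p ^ k"
      using Suc by (simp add: algebra_simps)
    finally show ?thesis .
  qed
qed

text \<open>Lifts a likelihood ratio bound from points to events. The bound is asked for only inside
  \<open>E\<close>, so bad configurations can be removed from the event first.\<close>

lemma prob_le_of_pmf_le:
  assumes "finite (set_pmf p)" "R \<ge> 0"
    and "\<And>x. x \<in> set_pmf p \<Longrightarrow> x \<in> E \<Longrightarrow> pmf p x \<le> R * pmf q x"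
  shows "measure_pmf.prob p E \<le> R * measure_pmf.prob q E"
proof -
  let ?F = "E \<inter> set_pmf p"
  have "measure_pmf.prob p E = measure_pmf.prob p ?F"
    by (simp add: measure_Int_set_pmf)
  also have "\<dots> = (\<Sum>x\<in>?F. pmf p x)"
    using assms by (intro measure_measure_pmf_finite) auto
  also have "\<dots> \<le> (\<Sum>x\<in>?F. R * pmf q x)"
    using assms by (intro sum_mono) auto
  also have "\<dots> = R * measure_pmf.prob q ?F"
    using assms by (subst measure_measure_pmf_finite) (auto simp: sum_distrib_left)
  also have "\<dots> \<le> R * measure_pmf.prob q E"
    using assms by (intro mult_left_mono measure_pmf.finite_measure_mono) auto
  finally show ?thesis .
qed

section \<open>Estimates for factorials and logarithms\<close>

text \<open>The upper half of Stirling's formula in logarithmic form. The induction step amounts to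
  \<open>1 \<le> (n + 1 / 2) * ln (1 + 1 / n)\<close>.\<close>

lemma ln_fact_le:
  assumes "n > 0"
  shows "ln (fact n) \<le> 1 + ln n / 2 + n * ln n - n"
  using assms
proof (induction n rule: nat_induct_non_zero)
  case 1
  then show ?case by simp
next
  case (Suc n)
  define d where "d = ln (real n + 1) - ln n"
  have "2 / (2 * n + 1) \<le> d"
    using ln_inverse_approx_ge[of n "real n + 1"] Suc.hyps by (simp add: d_def add.commute)
  then have "1 \<le> (n + 1 / 2) * d"
    by (simp add: field_simps)
  moreover have "ln (fact (Suc n)) = ln (real n + 1) + ln (fact n)"
    by (simp add: ln_mult add.commute)
  ultimately show ?case
    using Suc.IH by (simp add: d_def algebra_simps add_divide_distrib)
qed

text \<open>The difference of the two sides vanishes at \<open>0\<close> and has derivative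
  \<open>y * (1 - 2 * y) / (1 - y)\<close>, which is non-negative up to
  \<open>1 / 2\<close>.\<close>

lemma ln_one_minus_ge:
  fixes x :: real
  assumes "0 \<le> x" "x \<le> 1 / 2"
  shows "- x - x\<^sup>2 \<le> ln (1 - x)"
proof -
  have "(\<lambda>x. ln (1 - x) + x + x\<^sup>2) 0 \<le> (\<lambda>x. ln (1 - x) + x + x\<^sup>2) x"
  proof (rule DERIV_nonneg_imp_nondecreasing[OF assms(1)])
    fix y assume y: "0 \<le> y" "y \<le> x"
    have "((\<lambda>x. ln (1 - x) + x + x\<^sup>2) has_real_derivative (- 1 / (1 - y) + 1 + 2 * y)) (at y)"
      using y assms by (auto intro!: derivative_eq_intros)
    moreover have "- 1 / (1 - y) + 1 + 2 * y = y * (1 - 2 * y) / (1 - y)"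
      using y assms by (simp add: field_simps power2_eq_square)
    moreover have "y * (1 - 2 * y) / (1 - y) \<ge> 0"
      using y assms by (intro divide_nonneg_nonneg mult_nonneg_nonneg) auto
    ultimately show "\<exists>D. ((\<lambda>x. ln (1 - x) + x + x\<^sup>2) has_real_derivative D) (at y) \<and> 0 \<le> D"
      by metis
  qed
  then show ?thesis by simp
qed

text \<open>Apply \<open>ln y \<le> y / exp 1\<close> to \<open>y = sqrt x\<close>; with
  \<open>exp 1 \<ge> 5 / 2\<close> the constant is \<open>(4 / 5)\<^sup>2 = 16 / 25\<close>, below
  \<open>2 / 3\<close>.\<close>

lemma ln_square_le:
  fixes x :: real
  assumes "x \<ge> 1"
  shows "(ln x)\<^sup>2 \<le> 2 / 3 * x"
proof -
  have e: "exp 1 \<ge> (5 / 2 :: real)"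
    using exp_lower_Taylor_quadratic[of 1] by simp
  have "ln (sqrt x / exp 1) \<le> sqrt x / exp 1 - 1"
    using assms by (intro ln_le_minus_one) simp
  then have "ln x \<le> 2 * (sqrt x / exp 1)"
    using assms by (simp add: ln_div ln_sqrt field_simps)
  also have "\<dots> \<le> 2 * (sqrt x / (5 / 2))"
    using e assms by (intro mult_left_mono divide_left_mono) auto
  finally have "(ln x)\<^sup>2 \<le> (2 * (sqrt x / (5 / 2)))\<^sup>2"
    using assms by (intro power_mono) auto
  also have "\<dots> \<le> 2 / 3 * x"
    using assms by (simp add: power_mult_distrib power_divide)
  finally show ?thesis .
qed

text \<open>Pair the factors \<open>s - j\<close> and \<open>s - (c - 1 - j)\<close> of the falling factorial.\<close>
lemma falling_factorial_square_ge:
  fixes s t c :: nat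
  assumes "c \<le> s" "c \<le> t + 1" "t \<le> s"
  shows "(real s * (real s - real t)) ^ c \<le> (real (s choose c) * fact c)\<^sup>2"
proof -
  let ?f = "\<lambda>j. real s - real j"
  have fall: "real (s choose c) * fact c = (\<Prod>j<c. ?f j)"
    by (simp add: binomial_gbinomial gbinomial_prod_rev atLeast0LessThan)
  have "(real s * (real s - real t)) ^ c = (\<Prod>j<c. real s * (real s - real t))"
    by simp
  also have "\<dots> \<le> (\<Prod>j<c. ?f j * ?f (c - Suc j))"
  proof (rule prod_mono, intro conjI)
    fix j assume j: "j \<in> {..<c}"
    have "real s * (real s - real t) \<le> real s * (real s - real (c - 1))"
      using assms by (intro mult_left_mono) auto
    \<comment> \<open>The paired product exceeds \<open>s * (s - (c - 1))\<close> by exactly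
      \<open>j * (c - 1 - j)\<close>.\<close>
    also have "\<dots> \<le> real s * (real s - real (c - 1)) + real j * real (c - Suc j)"
      by simp
    also have "\<dots> = ?f j * ?f (c - Suc j)"
      using j by (simp add: of_nat_diff algebra_simps)
    finally show "real s * (real s - real t) \<le> ?f j * ?f (c - Suc j)" .
  qed (use assms in auto)
  also have "\<dots> = (\<Prod>j<c. ?f j) * (\<Prod>j<c. ?f (c - Suc j))"
    by (rule prod.distrib)
  also have "(\<Prod>j<c. ?f (c - Suc j)) = (\<Prod>j<c. ?f j)"
    by (rule prod.nat_diff_reindex)
  finally show ?thesis
    unfolding fall by (simp add: power2_eq_square)
qed

section \<open>Bounding the likelihood ratio\<close>

text \<open>Here \<open>- ln (1 - p)\<close> is at most \<open>p / (1 - p)\<close>, hence at most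
  \<open>?q * p\<close> for \<open>p \<le> 1 / (2 * s)\<close>. Over all factors this costs at most
  \<open>s * ?q = s + s / (2 * s - 1)\<close>, and the last fraction is at most \<open>2 / 3\<close>
  for \<open>s \<ge> 2\<close>.\<close>

lemma prod_one_minus_power_ge:
  fixes p :: "'a \<Rightarrow> real" and c :: "'a \<Rightarrow> nat"
  assumes "s \<ge> 2" "\<And>i. i \<in> A \<Longrightarrow> 0 \<le> p i" "\<And>i. i \<in> A \<Longrightarrow> p i \<le> 1 / (2 * real s)"
    and "(\<Sum>i\<in>A. p i) \<le> 1"
  shows "exp (- real s - 2 / 3) \<le> (\<Prod>i\<in>A. (1 - p i) ^ (s - c i))"
proof (cases "finite A")
  case True
  let ?q = "2 * real s / (2 * real s - 1)"
  have "real s * ?q \<le> real s + 2 / 3"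
    using assms(1) by (simp add: field_simps)
  moreover have "real s * ?q * (\<Sum>i\<in>A. p i) \<le> real s * ?q"
    using assms by (intro mult_left_le) auto
  ultimately have "exp (- real s - 2 / 3) \<le> exp (\<Sum>i\<in>A. - real s * ?q * p i)"
    by (simp add: sum_distrib_left sum_negf)
  also have "\<dots> = (\<Prod>i\<in>A. exp (- real s * ?q * p i))"
    using True by (rule exp_sum)
  also have "\<dots> \<le> (\<Prod>i\<in>A. (1 - p i) ^ (s - c i))"
  proof (rule prod_mono, intro conjI)
    fix i assume i: "i \<in> A"
    have s2: "1 / (2 * real s) \<le> 1 / 4" using assms(1) by (simp add: field_simps)
    have p: "0 \<le> p i" "p i \<le> 1 / (2 * real s)" using assms i by auto
    then have p4: "p i \<le> 1 / 4" using s2 by linarith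
    have "ln (1 / (1 - p i)) \<le> 1 / (1 - p i) - 1"
      using p p4 by (intro ln_le_minus_one) auto
    also have "\<dots> = p i * (1 / (1 - p i))"
      using p p4 by (simp add: field_simps)
    also have "\<dots> \<le> p i * (1 / (1 - 1 / (2 * real s)))"
      using p p4 s2 by (intro mult_left_mono divide_left_mono) auto
    also have "1 / (1 - 1 / (2 * real s)) = ?q"
      using assms(1) by (simp add: field_simps)
    finally have "- (?q * p i) \<le> ln (1 - p i)"
      using p p4 by (simp add: ln_div mult.commute)
    then have "exp (- (?q * p i)) \<le> 1 - p i"
      using p p4 by (subst (asm) ln_ge_iff) auto
    then have "exp (- (?q * p i)) ^ s \<le> (1 - p i) ^ s"
      by (intro power_mono) auto
    also have "\<dots> \<le> (1 - p i) ^ (s - c i)"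
      using p p4 by (intro power_decreasing) auto
    finally show "exp (- real s * ?q * p i) \<le> (1 - p i) ^ (s - c i)"
      by (simp flip: exp_of_nat_mult add: mult.assoc)
  qed auto
  finally show ?thesis .
qed auto

text \<open>Once the powers \<open>p i ^ c i\<close> cancel, \<open>fact s\<close> over this product
  is the likelihood ratio of type I to type II at \<open>c\<close>. Stirling's bound contributes
  \<open>s powr (1 / 2)\<close> to it and the falling factorials a further factor
  \<open>s\<close>.\<close>

lemma fact_le_type_II_factor:
  fixes p :: "'a \<Rightarrow> real" and c :: "'a \<Rightarrow> nat"
  assumes "finite A" "s \<ge> 2" "real t \<le> 2 * ln s" "2 * t \<le> s"
    and "\<And>i. i \<in> A \<Longrightarrow> 0 \<le> p i" "\<And>i. i \<in> A \<Longrightarrow> p i \<le> 1 / (2 * real s)" "(\<Sum>i\<in>A. p i) \<le> 1"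
    and "\<And>i. i \<in> A \<Longrightarrow> c i \<le> t + 1" and "(\<Sum>i\<in>A. c i) = s"
  shows "fact s \<le> 30 * s powr (3 / 2) * (\<Prod>i\<in>A. (s choose c i) * fact (c i) * (1 - p i) ^ (s - c i))"
proof -
  define L where "L = ln s"
  define x where "x = real t / s"
  define F where "F = (\<Prod>i\<in>A. real (s choose c i) * fact (c i))"
  have s: "real s \<ge> 2" and L: "0 \<le> L" using assms(2) by (auto simp: L_def)
  have x: "0 \<le> x" "x \<le> 1 / 2" and tx: "real t = s * x"
    using assms(2,4) by (auto simp: x_def field_simps)
  have c_le: "c i \<le> s" if "i \<in> A" for i
    using member_le_sum[of i A c] that assms(1,9) by simp
  \<comment> \<open>The exponents \<open>c i\<close> add up to \<open>s\<close>, so the bounds for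
    the single factors multiply to one \<open>s\<close>-th power.\<close>
  have "(real s * (real s - real t)) ^ s = (\<Prod>i\<in>A. (real s * (real s - real t)) ^ c i)"
    by (simp add: power_sum[symmetric] assms(9))
  also have "\<dots> \<le> (\<Prod>i\<in>A. (real (s choose c i) * fact (c i))\<^sup>2)"
    using assms c_le by (intro prod_mono conjI falling_factorial_square_ge zero_le_power mult_nonneg_nonneg) auto
  also have "\<dots> = F\<^sup>2"
    by (simp add: F_def prod_power_distrib)
  finally have F2: "(real s * (real s - real t)) ^ s \<le> F\<^sup>2" .
  have pos: "real s * (real s - real t) > 0" using assms(2,4) by simp
  have "F \<ge> 0" unfolding F_def by (intro prod_nonneg) auto
  moreover have "F \<noteq> 0" using F2 zero_less_power[OF pos, of s] by auto
  ultimately have F: "F > 0" by simp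
  have "real s - real t = s * (1 - x)" by (simp add: tx algebra_simps)
  then have "ln (real s * (real s - real t)) = 2 * L + ln (1 - x)"
    using s x by (simp add: ln_mult L_def)
  then have "s * (2 * L + ln (1 - x)) \<le> 2 * ln F"
    using F2 F pos by (metis ln_mono ln_realpow of_nat_numeral zero_less_power)
  moreover have "real s * (- x - x\<^sup>2) \<le> real s * ln (1 - x)"
    using x by (intro mult_left_mono ln_one_minus_ge) auto
  moreover have "real s * x \<le> 2 * L" using assms(3) by (simp add: tx L_def)
  moreover have "real s * x\<^sup>2 \<le> 8 / 3"
  proof -
    have "(real s * x)\<^sup>2 \<le> (2 * L)\<^sup>2"
      using x assms(3) by (intro power_mono) (auto simp: tx L_def)
    also have "\<dots> \<le> 8 / 3 * s"
      using ln_square_le[of s] s by (simp add: L_def power_mult_distrib)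
    finally have "real s * (real s * x\<^sup>2) \<le> real s * (8 / 3)"
      by (simp add: power2_eq_square algebra_simps)
    then show ?thesis using s by simp
  qed
  \<comment> \<open>After halving, \<open>s * x \<le> 2 * L\<close> costs the term \<open>L\<close>
    and \<open>s * x\<^sup>2 \<le> 8 / 3\<close> costs \<open>4 / 3\<close>.\<close>
  ultimately have "s * L - L - 4 / 3 \<le> ln F"
    by (simp add: algebra_simps)
  moreover have "ln (fact s) \<le> 1 + L / 2 + s * L - s"
    using ln_fact_le[of s] assms(2) by (simp add: L_def)
  \<comment> \<open>The constant \<open>1 + 4 / 3\<close> is written as \<open>3 - 2 / 3\<close> to
    expose the exponent of \<open>prod_one_minus_power_ge\<close>; \<open>exp 3 \<le> 27\<close>
    then fits under \<open>30\<close>.\<close>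
  ultimately have "ln (fact s) \<le> 3 + 3 / 2 * L + ln F + (- real s - 2 / 3)"
    by simp
  then have "exp (ln (fact s)) \<le> exp (3 + 3 / 2 * L + ln F + (- real s - 2 / 3))"
    by (simp only: exp_le_cancel_iff)
  also have "\<dots> = exp 3 * exp (3 / 2 * L) * exp (ln F) * exp (- real s - 2 / 3)"
    by (simp only: exp_add)
  also have "\<dots> = exp 3 * s powr (3 / 2) * F * exp (- real s - 2 / 3)"
    using F s by (simp add: powr_def L_def)
  finally have "fact s \<le> exp 3 * s powr (3 / 2) * F * exp (- real s - 2 / 3)"
    by simp
  also have "\<dots> \<le> 30 * s powr (3 / 2) * F * (\<Prod>i\<in>A. (1 - p i) ^ (s - c i))"
  proof (intro mult_mono prod_one_minus_power_ge)
    have "exp 3 = exp (1 :: real) ^ 3" by (simp flip: exp_of_nat_mult)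
    also have "\<dots> \<le> (3 :: real) ^ 3" by (intro power_mono exp_le) auto
    finally show "exp 3 \<le> (30 :: real)" by simp
  qed (use assms F in auto)
  also have "\<dots> = 30 * s powr (3 / 2) * (\<Prod>i\<in>A. (s choose c i) * fact (c i) * (1 - p i) ^ (s - c i))"
    by (simp add: F_def prod.distrib)
  finally show ?thesis .
qed

text \<open>The term of index \<open>k\<close> in the series of \<open>exp k\<close> is at most the
  whole sum.\<close>

lemma fact_ge_power_div_exp: "(real k / exp 1) ^ k \<le> fact k"
proof -
  have "real k ^ k / fact k \<le> exp (real k)"
    using exp_converges[of "real k"] sum_le_suminf[of "\<lambda>n. real k ^ n /\<^sub>R fact n" "{k}"]
    by (auto simp: sums_iff divide_inverse mult.commute)
  then have "real k ^ k \<le> fact k * exp (real k)"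
    by (simp add: field_simps)
  also have "exp (real k) = exp 1 ^ k"
    by (simp flip: exp_of_nat_mult)
  finally show ?thesis by (simp add: power_divide field_simps)
qed

section \<open>Truncation level and large counts\<close>

text \<open>The first two properties cap \<open>t\<close> as \<open>fact_le_type_II_factor\<close>
  requires; the third makes \<open>t + 2\<close>, the first excluded count, rare enough for the
  union bound.\<close>

lemma ex_truncation_level:
  assumes "s \<ge> 3"
  obtains t :: nat where "real t \<le> 2 * ln s" "2 * t \<le> s"
    "2 * real s / (2 ^ (t + 2) * fact (t + 2)) \<le> 1 / s powr (ln (ln s))"
proof -
  define L where "L = ln s"
  have s_exp: "real s = exp L" using assms by (simp add: L_def)
  have e2: "exp 1 \<ge> (5 / 2 :: real)"
    using exp_lower_Taylor_quadratic[of 1] by simp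
  show thesis
  proof (cases "s \<le> 8")
    \<comment> \<open>For \<open>s\<close> from \<open>3\<close> to \<open>8\<close> the witness is
      \<open>s div 2\<close>, checked numerically. Since \<open>L \<le> 5 / 2 \<le> exp 1\<close>
      gives \<open>ln L \<le> 1\<close>, a tail of at most \<open>1 / s\<close> suffices.\<close>
    case True
    have pow1: "8 \<le> exp (5 / 2 :: real)"
    proof -
      have "(8 :: real) \<le> (13 / 8) ^ 5" by (simp add: power_divide)
      also have "\<dots> \<le> exp (1 / 2 :: real) ^ 5"
        using exp_lower_Taylor_quadratic[of "1 / 2"]
        by (intro power_mono) (simp_all add: power2_eq_square)
      finally show ?thesis by (simp flip: exp_of_nat_mult)
    qed
    have "exp L \<le> exp (5 / 2)"
      using pow1 True by (simp flip: s_exp)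
    then have L: "0 < L" "L \<le> 5 / 2"
      using assms by (simp add: L_def, simp only: exp_le_cancel_iff)
    have "ln L \<le> 1"
      using L e2 by (metis exp_gt_zero ln_exp ln_mono order_trans)
    then have "s powr ln L \<le> s powr 1"
      using assms by (intro powr_mono) auto
    then have main: "1 / s \<le> 1 / s powr ln (ln s)"
      using assms by (simp add: L_def divide_left_mono)
    have "s \<in> {3, 4, 5, 6, 7, 8}" using True assms by auto
    then have sq: "(272 / 100) ^ (s div 2) \<le> (real s)\<^sup>2"
      and tail: "2 * real s / (2 ^ (s div 2 + 2) * fact (s div 2 + 2)) \<le> 1 / s"
      by (auto simp: fact_numeral power_divide)
    have "exp (real (s div 2)) = exp 1 ^ (s div 2)"
      by (simp flip: exp_of_nat_mult)
    also have "\<dots> \<le> (272 / 100) ^ (s div 2)"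
      using e_less_272 by (intro power_mono) auto
    also note sq
    finally have "exp (real (s div 2)) \<le> (real s)\<^sup>2" .
    then have "s div 2 \<le> ln ((real s)\<^sup>2)"
      using assms by (subst ln_ge_iff) auto
    then have "real (s div 2) \<le> 2 * ln s"
      using assms by (simp add: ln_realpow)
    then show thesis
      using tail main by (intro that[of "s div 2"]) auto
  next
    case False
    then have s: "real s \<ge> 9" by simp
    define t where "t = nat \<lfloor>2 * L\<rfloor>"
    define k where "k = t + 2"
    have "exp 2 \<le> (9 :: real)"
      using power_mono[OF less_imp_le[OF e_less_272], of 2]
      by (simp add: exp_double[of 1, simplified] power2_eq_square)
    then have "exp 2 \<le> real s" using s by linarith
    then have L: "2 \<le> L"
      using s by (simp add: L_def ln_ge_iff)
    have "real t = \<lfloor>2 * L\<rfloor>" using L by (simp add: t_def)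
    then have t: "t \<le> 2 * L" "2 * L < t + 1" by linarith+
    have "2 * t \<le> s"
    proof -
      \<comment> \<open>The power \<open>18\<close> is chosen since \<open>18 / 8 = 9 / 4\<close>.
        The tangent of \<open>ln\<close> at \<open>9\<close> then yields
        \<open>L \<le> s / 9 + 5 / 4\<close>, which is at most \<open>s / 4\<close> from
        \<open>s = 9\<close> on.\<close>
      have "(1 + 1 / 8 + 1 / 128) ^ 18 \<le> exp (1 / 8 :: real) ^ 18"
        using exp_lower_Taylor_quadratic[of "1 / 8"] by (intro power_mono) (auto simp: power2_eq_square)
      then have "9 \<le> exp (9 / 4 :: real)"
        by (simp add: power_divide flip: exp_of_nat_mult)
      then have "ln 9 \<le> (9 / 4 :: real)"
        by (metis ln_exp ln_mono zero_less_numeral)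
      moreover have "ln (s / 9) \<le> s / 9 - 1"
        using s by (intro ln_le_minus_one) auto
      moreover have "L = ln 9 + ln (s / 9)"
        using s by (simp add: L_def ln_div)
      ultimately have "4 * L \<le> s" using s by argo
      then have "real (2 * t) \<le> real s" using t by simp
      then show ?thesis by linarith
    qed
    moreover have "2 * real s / (2 ^ k * fact k) \<le> 1 / s powr (ln L)"
    proof -
      define l where "l = ln L"
      have ln2: "2 / 3 \<le> ln (2 :: real)" "ln (2 :: real) \<le> 1"
        using ln2_ge_two_thirds ln_le_minus_one[of 2] by auto
      have "ln 2 \<le> l"
        using L by (simp add: l_def)
      then have l: "2 / 3 \<le> l"
        using ln2 by linarith
      have k: "2 * L + 1 \<le> k" "k > 0" using t by (auto simp: k_def)
      have "ln (4 * L) \<le> ln (2 * real k)"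
        using k L by (intro ln_mono) auto
      moreover have "ln (4 * L) = 2 * ln 2 + l"
        using L ln_realpow[of 2 2] by (simp add: ln_mult l_def)
      ultimately have lnk: "1 / 3 + l \<le> ln (2 * real k) - 1"
        using ln2 by linarith
      \<comment> \<open>The left side is the logarithm of \<open>2 * s * s powr l\<close>; the right
        side is below that of \<open>(2 * k / exp 1) ^ k\<close>, as
        \<open>k \<ge> 2 * L + 1\<close>.\<close>
      have "ln 2 + L + L * l \<le> (2 * L + 1) * (1 / 3 + l)"
      proof -
        have "L * (2 / 3) \<le> L * l" using l L by (intro mult_left_mono) auto
        moreover have "(2 * L + 1) * (1 / 3 + l) = 2 * L / 3 + 1 / 3 + 2 * (L * l) + l"
          by (simp add: algebra_simps)
        ultimately show ?thesis using ln2 l L by linarith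
      qed
      also have "\<dots> \<le> k * (ln (2 * real k) - 1)"
        using k L l lnk by (intro mult_mono) auto
      finally have "exp (ln 2 + L + L * l) \<le> exp (k * (ln (2 * real k) - 1))"
        by simp
      also have "\<dots> = (2 * real k / exp 1) ^ k"
        using k by (simp add: exp_of_nat_mult exp_diff)
      also have "\<dots> = 2 ^ k * (real k / exp 1) ^ k"
        by (simp flip: power_mult_distrib)
      also have "\<dots> \<le> 2 ^ k * fact k"
        by (intro mult_left_mono fact_ge_power_div_exp) auto
      finally have "2 * s * s powr l \<le> 2 ^ k * fact k"
        using s by (simp add: exp_add s_exp powr_def mult.commute)
      then show ?thesis
        using s by (simp add: l_def field_simps)
    qed
    ultimately show thesis
      using t that[of t] by (simp add: k_def L_def)
  qed
qed

lemma finite_set_type_I_sampling: "finite (set_pmf P) \<Longrightarrow> finite (set_pmf (type_I_sampling s P))"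
  unfolding type_I_sampling_def set_map_pmf set_replicate_pmf
  using finite_lists_length_eq[of "set_pmf P" s] by (simp add: lists_eq_set)

text \<open>Union bound over the elements. One factor \<open>pmf P i\<close> is kept so that the sum
  over \<open>i\<close> becomes \<open>1\<close>; the other \<open>k - 1\<close> factors are bounded
  by \<open>1 / (2 * s)\<close> and cancel all but one power of \<open>s\<close>.\<close>

lemma prob_type_I_sampling_ge:
  assumes "finite (set_pmf P)" "s > 0" "\<And>i. pmf P i \<le> 1 / (2 * real s)" "k > 0"
  shows "measure_pmf.prob (type_I_sampling s P) {c. \<exists>i\<in>set_pmf P. c i \<ge> k} \<le> 2 * real s / (2 ^ k * fact k)"
proof -
  let ?D = "type_I_sampling s P"
  have "{c. \<exists>i\<in>set_pmf P. c i \<ge> k} = (\<Union>i\<in>set_pmf P. {c. c i \<ge> k})" by auto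
  then have "measure_pmf.prob ?D {c. \<exists>i\<in>set_pmf P. c i \<ge> k} \<le>
      (\<Sum>i\<in>set_pmf P. measure_pmf.prob ?D {c. c i \<ge> k})"
    using assms(1) by (simp add: measure_pmf.finite_measure_subadditive_finite)
  also have "\<dots> \<le> (\<Sum>i\<in>set_pmf P. (2 * real s / (2 ^ k * fact k)) * pmf P i)"
  proof (rule sum_mono)
    fix i assume "i \<in> set_pmf P"
    have "measure_pmf.prob ?D {c. c i \<ge> k} = measure_pmf.prob (map_pmf (\<lambda>c. c i) ?D) {k..}"
      by (simp add: measure_map_pmf vimage_def atLeast_def)
    also have "\<dots> \<le> real (s choose k) * pmf P i ^ k"
      unfolding map_pmf_type_I_sampling by (intro prob_binomial_pmf_ge) (auto simp: pmf_le_1)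
    also have "\<dots> \<le> (real s ^ k / fact k) * ((1 / (2 * real s)) ^ (k - 1) * pmf P i)"
    proof (intro mult_mono)
      have "real ((s choose k) * fact k) \<le> real (s ^ k)"
        using binomial_fact_pow[of s k] by (simp only: of_nat_le_iff)
      then show "real (s choose k) \<le> real s ^ k / fact k"
        by (simp add: field_simps)
      have "pmf P i ^ k = pmf P i ^ (k - 1) * pmf P i"
        using assms(4) by (metis power_minus_mult)
      also have "\<dots> \<le> (1 / (2 * real s)) ^ (k - 1) * pmf P i"
        using assms(3) by (intro mult_right_mono power_mono) auto
      finally show "pmf P i ^ k \<le> (1 / (2 * real s)) ^ (k - 1) * pmf P i" .
    qed auto
    also have "\<dots> = (2 * real s / (2 ^ k * fact k)) * pmf P i"
      using assms(2,4) by (cases k) (simp_all add: power_divide power_mult_distrib del: fact_Suc)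
    finally show "measure_pmf.prob ?D {c. c i \<ge> k} \<le> (2 * real s / (2 ^ k * fact k)) * pmf P i" .
  qed
  also have "\<dots> = 2 * real s / (2 ^ k * fact k)"
    by (subst sum_distrib_left[symmetric]) (simp add: sum_pmf_eq_1 assms(1))
  finally show ?thesis .
qed

section \<open>Splitting off configurations with a large count\<close>

theorem lemma5:
  fixes n s :: nat and P :: "nat pmf" and \<alpha> :: "nat \<Rightarrow> real" and r :: real
  assumes "s \<ge> 2"
    and "set_pmf P \<subseteq> {1..n}"
    and "\<And>i. i \<in> {1..n} \<Longrightarrow> pmf P i \<le> 1 / (2 * real s)"
    and "\<And>i. i \<in> {1..n} \<Longrightarrow> \<alpha> i \<ge> 0"
    and "r \<ge> 0"
  shows
    "measure_pmf.prob (type_I_sampling s P)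
        {c. \<bar>weight n \<alpha> c - measure_pmf.expectation (type_I_sampling s P) (weight n \<alpha>)\<bar> > r}
      \<le> 30 * real s powr (3 / 2) *
          measure_pmf.prob (type_II_sampling n s P)
            {c. \<bar>weight n \<alpha> c - measure_pmf.expectation (type_II_sampling n s P) (weight n \<alpha>)\<bar> > r}
        + 1 / real s powr (ln (ln (real s)))"
proof -
  let ?I = "type_I_sampling s P" and ?II = "type_II_sampling n s P"
  define \<mu> where "\<mu> = measure_pmf.expectation ?II (weight n \<alpha>)"
  define E where "E = {c. \<bar>weight n \<alpha> c - \<mu>\<bar> > r}"
  have mean: "measure_pmf.expectation ?I (weight n \<alpha>) = \<mu>"
    unfolding \<mu>_def
    by (subst (1 2) expectation_weight[of _ _ s P])
       (auto simp: map_pmf_type_I_sampling map_pmf_type_II_sampling)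
  have fin: "finite (set_pmf P)" using assms(2) finite_subset by blast
  have p_le: "pmf P i \<le> 1 / (2 * real s)" for i
  proof (cases "i \<in> {1..n}")
    case False
    then have "pmf P i = 0" using assms(2) by (auto simp: pmf_eq_0_set_pmf)
    then show ?thesis by simp
  qed (rule assms(3))
  have p_sum: "(\<Sum>i=1..n. pmf P i) = 1"
    using assms(2) by (intro sum_pmf_eq_1) auto
  have "measure_pmf.prob ?I E \<le> 30 * s powr (3 / 2) * measure_pmf.prob ?II E + 1 / s powr (ln (ln s))"
  \<comment> \<open>For \<open>s = 2\<close> the exponent \<open>ln (ln s)\<close> is not positive,
    so the error term alone is at least \<open>1\<close>.\<close>
  proof (cases "s = 2")
    case True
    have "ln (ln 2) \<le> (0 :: real)"
      using ln_le_minus_one[of "ln 2"] ln_le_minus_one[of 2] by simp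
    then have "2 powr ln (ln 2) \<le> (2 :: real) powr 0"
      by (intro powr_mono) auto
    then have "1 \<le> 1 / s powr (ln (ln s))"
      using True by simp
    moreover have "measure_pmf.prob ?I E \<le> 1" by simp
    moreover have "0 \<le> 30 * s powr (3 / 2) * measure_pmf.prob ?II E" by simp
    ultimately show ?thesis by linarith
  next
    case False
    then have "s \<ge> 3" using assms(1) by simp
    from ex_truncation_level[OF this] obtain t :: nat where t: "real t \<le> 2 * ln s" "2 * t \<le> s"
      and tail: "2 * real s / (2 ^ (t + 2) * fact (t + 2)) \<le> 1 / s powr (ln (ln s))" .
    \<comment> \<open>Off \<open>B\<close> every count is at most \<open>t + 1\<close>, exactly what
      the ratio bound needs.\<close>
    define B where "B = {c :: nat \<Rightarrow> nat. \<exists>i\<in>set_pmf P. c i \<ge> t + 2}"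
    have "measure_pmf.prob ?I E \<le> measure_pmf.prob ?I ((E - B) \<union> B)"
      by (intro measure_pmf.finite_measure_mono) auto
    also have "\<dots> \<le> measure_pmf.prob ?I (E - B) + measure_pmf.prob ?I B"
      by (intro measure_subadditive) auto
    also have "measure_pmf.prob ?I B \<le> 1 / s powr (ln (ln s))"
      unfolding B_def using prob_type_I_sampling_ge[of P s "t + 2"] fin p_le assms(1) tail
      by simp
    also have "measure_pmf.prob ?I (E - B) \<le> 30 * s powr (3 / 2) * measure_pmf.prob ?II (E - B)"
    proof (rule prob_le_of_pmf_le)
      show "finite (set_pmf ?I)" using fin by (rule finite_set_type_I_sampling)
    next
      fix c assume c: "c \<in> set_pmf ?I" "c \<in> E - B"
      from c(1) obtain xs where xs: "c = count_list xs" "set xs \<subseteq> set_pmf P" "length xs = s"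
        by (auto simp: type_I_sampling_def set_replicate_pmf)
      have out: "c i = 0" if "i \<notin> set_pmf P" for i
        using that xs by (auto simp: count_list_0_iff)
      have "c i \<le> t + 1" for i
        using c(2) out[of i] by (cases "i \<in> set_pmf P") (auto simp: B_def not_le)
      moreover have "(\<Sum>i=1..n. c i) = s"
        using sum_count_set[of xs "{1..n}"] xs assms(2) by auto
      ultimately have "fact s \<le> 30 * s powr (3 / 2) *
          (\<Prod>i=1..n. (s choose c i) * fact (c i) * (1 - pmf P i) ^ (s - c i))" (is "_ \<le> ?R * ?F")
        using t assms(1) p_le p_sum by (intro fact_le_type_II_factor[where t = t]) auto
      then have "fact s * (\<Prod>i=1..n. pmf P i ^ c i / fact (c i)) \<le>
          ?R * ?F * (\<Prod>i=1..n. pmf P i ^ c i / fact (c i))"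
        by (intro mult_right_mono prod_nonneg) auto
      \<comment> \<open>The factors \<open>fact (c i)\<close> cancel against the denominators of the
        multinomial coefficient.\<close>
      also have "\<dots> = ?R * (\<Prod>i=1..n. (s choose c i) * pmf P i ^ c i * (1 - pmf P i) ^ (s - c i))"
        by (simp add: mult.assoc flip: prod.distrib) (simp add: mult_ac)
      also have "\<dots> = ?R * pmf ?II c"
      proof -
        \<comment> \<open>Type II sampling gives positive mass only to configurations with the
          default count \<open>0\<close> outside \<open>{1..n}\<close>.\<close>
        have "c i = 0" if "i \<notin> {1..n}" for i using that out assms(2) by blast
        then show ?thesis
          using pmf_type_II_sampling[of n c s P] by presburger
      qed
      also have "fact s * (\<Prod>i=1..n. pmf P i ^ c i / fact (c i)) = pmf ?I c"
        using c(1) assms(2) by (subst pmf_type_I_sampling[of "{1..n}"]) auto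
      finally show "pmf ?I c \<le> ?R * pmf ?II c" .
    qed simp
    also have "measure_pmf.prob ?II (E - B) \<le> measure_pmf.prob ?II E"
      by (intro measure_pmf.finite_measure_mono) auto
    finally show ?thesis by (simp add: mult_left_mono)
  qed
  then show ?thesis
    unfolding E_def mean \<mu>_def .
qed

end
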